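(* Let $X$ be a countably infinite set. Then the maximal subsemigroups of $I_X$ which contain $\operatorname{Sym}(X)$ are exactly the following four: $$S = \{ f \in I_X \mid c(f) > 0 \text{ or } d(f) = 0 \},$$ $$S^{-1} = \{ f \in I_X \mid c(f) = 0 \text{ or } d(f) > 0 \},$$ $$T = \{ f \in I_X \mid c(f) = \aleph_0 \text{ or } d(f) < \aleph_0 \},$$ $$T^{-1} = \{ f \in I_X \mid c(f) < \aleph_0 \text{ or } d(f) = \aleph_0 \}.$$
   Context: For a set $X$, $I_X$ is the symmetric inverse monoid: the set of all bijections between subsets of $X$ (partial bijections, called charts) under composition of partial functions, written left to right. $\operatorname{Sym}(X) \subseteq I_X$ is the group of all permutations of $X$. For $f \in I_X$, the defect is $d(f) = |X \setminus \operatorname{im}(f)|$ and the collapse is $c(f) = |X \setminus \operatorname{dom}(f)|$. A maximal subsemigroup of $I_X$ is a proper subsemigroup that is maximal under containment among the proper subsemigroups of $I_X$. *)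

theory Defs
  imports "HOL-Algebra.Group" "HOL-Library.Countable_Set"
begin

unbundle cardinal_syntax

text \<open>
  A chart of \<open>X\<close> is a partial function \<open>f :: 'a \<rightharpoonup> 'a\<close> (so \<open>None\<close> means undefined) that is
  injective on its domain and has domain and image contained in \<open>X\<close>.
\<close>

definition charts :: "'a set \<Rightarrow> ('a \<rightharpoonup> 'a) set" where
  "charts X = {f. dom f \<subseteq> X \<and> ran f \<subseteq> X \<and> inj_on f (dom f)}"

text \<open>
  Charts are composed from left to right: \<open>f \<otimes> g\<close> applies \<open>f\<close> first, whereas \<open>g \<circ>\<^sub>m f\<close> is
  written from right to left.
\<close>

definition sym_inv_monoid :: "'a set \<Rightarrow> ('a \<rightharpoonup> 'a) monoid" where
  "sym_inv_monoid X = \<lparr>carrier = charts X, monoid.mult = (\<lambda>f g. g \<circ>\<^sub>m f), one = Some |` X\<rparr>"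

definition Sym :: "'a set \<Rightarrow> ('a \<rightharpoonup> 'a) set" where
  "Sym X = {f \<in> charts X. dom f = X \<and> ran f = X}"

text \<open>
  Defect and collapse are cardinal numbers in the sense of the library. They are compared up
  to \<open>=o\<close> and \<open><o\<close>, with \<open>natLeq\<close> as aleph-zero and \<open>czero\<close> as zero.
\<close>

definition defect :: "'a set \<Rightarrow> ('a \<rightharpoonup> 'a) \<Rightarrow> 'a rel" where
  "defect X f = |X - ran f|"

definition collapse :: "'a set \<Rightarrow> ('a \<rightharpoonup> 'a) \<Rightarrow> 'a rel" where
  "collapse X f = |X - dom f|"

definition subsemigroup :: "'b set \<Rightarrow> ('b, 'c) monoid_scheme \<Rightarrow> bool" where
  "subsemigroup M G \<longleftrightarrow>
     M \<subseteq> carrier G \<and> M \<noteq> {} \<and> (\<forall>x\<in>M. \<forall>y\<in>M. x \<otimes>\<^bsub>G\<^esub> y \<in> M)"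

definition maximal_subsemigroup :: "'b set \<Rightarrow> ('b, 'c) monoid_scheme \<Rightarrow> bool" where
  "maximal_subsemigroup M G \<longleftrightarrow>
     subsemigroup M G \<and> M \<noteq> carrier G \<and>
     (\<forall>N. subsemigroup N G \<and> N \<noteq> carrier G \<and> M \<subseteq> N \<longrightarrow> N = M)"

lemma monoid_sym_inv_monoid: "monoid (sym_inv_monoid X)"
proof (rule monoidI)
  fix f g assume "f \<in> carrier (sym_inv_monoid X)" "g \<in> carrier (sym_inv_monoid X)"
  then have f: "dom f \<subseteq> X" "inj_on f (dom f)"
    and g: "ran g \<subseteq> X" "inj_on g (dom g)"
    by (auto simp: sym_inv_monoid_def charts_def)
  have "dom (g \<circ>\<^sub>m f) \<subseteq> X"
    using f(1) by (auto simp: dom_def map_comp_def split: option.splits)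
  moreover have "ran (g \<circ>\<^sub>m f) \<subseteq> X"
    using g(1) by (auto simp: ran_def map_comp_def split: option.splits)
  moreover have "inj_on (g \<circ>\<^sub>m f) (dom (g \<circ>\<^sub>m f))"
  proof (rule inj_onI)
    fix x y
    assume "x \<in> dom (g \<circ>\<^sub>m f)" "y \<in> dom (g \<circ>\<^sub>m f)" and eq: "(g \<circ>\<^sub>m f) x = (g \<circ>\<^sub>m f) y"
    then obtain u v where uv: "f x = Some u" "u \<in> dom g" "f y = Some v" "v \<in> dom g"
      by (auto simp: map_comp_def dom_def split: option.splits)
    with eq have "g u = g v" by simp
    with uv g(2) have "u = v" by (auto dest: inj_onD)
    with uv f(2) show "x = y" by (auto simp: inj_on_def dom_def)
  qed
  ultimately show "f \<otimes>\<^bsub>sym_inv_monoid X\<^esub> g \<in> carrier (sym_inv_monoid X)"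
    by (simp add: sym_inv_monoid_def charts_def)
next
  show "\<one>\<^bsub>sym_inv_monoid X\<^esub> \<in> carrier (sym_inv_monoid X)"
    by (auto simp: sym_inv_monoid_def charts_def ran_def restrict_map_def inj_on_def
        split: if_splits)
next
  fix f g h
  show "f \<otimes>\<^bsub>sym_inv_monoid X\<^esub> g \<otimes>\<^bsub>sym_inv_monoid X\<^esub> h
      = f \<otimes>\<^bsub>sym_inv_monoid X\<^esub> (g \<otimes>\<^bsub>sym_inv_monoid X\<^esub> h)"
    by (auto simp: sym_inv_monoid_def map_comp_def fun_eq_iff split: option.splits)
next
  fix f assume "f \<in> carrier (sym_inv_monoid X)"
  then have "dom f \<subseteq> X" "ran f \<subseteq> X"
    by (auto simp: sym_inv_monoid_def charts_def)
  then have out: "x \<notin> X \<Longrightarrow> f x = None" and img: "f x = Some y \<Longrightarrow> y \<in> X" for x y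
    by (auto intro: ranI)
  show "\<one>\<^bsub>sym_inv_monoid X\<^esub> \<otimes>\<^bsub>sym_inv_monoid X\<^esub> f = f"
    by (auto simp: sym_inv_monoid_def map_comp_def restrict_map_def fun_eq_iff out)
  show "f \<otimes>\<^bsub>sym_inv_monoid X\<^esub> \<one>\<^bsub>sym_inv_monoid X\<^esub> = f"
    by (auto simp: sym_inv_monoid_def map_comp_def restrict_map_def fun_eq_iff
        dest: img split: option.splits)
qed

end

theory Submission
  imports Defs "HOL-Combinatorics.Transposition"
begin

text \<open>
  A subsemigroup that contains \<open>Sym X\<close> and lies in none of the four sets contains a chart \<open>a\<close> with
  collapse 0 and infinite defect, and a chart \<open>b\<close> with infinite collapse and defect 0. Every chart
  is a product \<open>a \<otimes> s \<otimes> b\<close> with \<open>s\<close> in \<open>Sym X\<close>, so such a subsemigroup is everything. Hence the four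
  sets are the only candidates, and they are all maximal because none of them contains another.
\<close>

section \<open>Cardinal conditions as emptiness and finiteness\<close>

lemma card_of_eq_czero_iff: "|A| =o czero \<longleftrightarrow> A = {}"
  by (metis card_of_empty3 card_of_empty_ordIso czero_def ordIso_iff_ordLeq)

lemma czero_less_card_of_iff: "czero <o |A| \<longleftrightarrow> A \<noteq> {}"
  by (metis card_of_Well_order card_of_empty card_of_empty3 czero_def not_ordLess_iff_ordLeq)

lemma card_of_eq_natLeq_iff:
  assumes "countable A"
  shows "|A| =o natLeq \<longleftrightarrow> infinite A"
proof
  show "infinite A" if "|A| =o natLeq"
    using that finite_iff_ordLess_natLeq not_ordLess_ordIso by blast
  assume "infinite A"
  then have "|A| =o |UNIV :: nat set|"
    using assms to_nat_on_infinite card_of_ordIso by blast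
  then show "|A| =o natLeq"
    using card_of_nat ordIso_transitive by blast
qed

section \<open>Collapse and defect of a product\<close>

lemma in_charts_iff:
  "f \<in> charts X \<longleftrightarrow> (\<forall>x y. f x = Some y \<longrightarrow> x \<in> X \<and> y \<in> X) \<and>
     (\<forall>x x' y. f x = Some y \<longrightarrow> f x' = Some y \<longrightarrow> x = x')"
  unfolding charts_def by (auto simp: ran_def inj_on_def dom_def)

lemma charts_ran_subset: "f \<in> charts X \<Longrightarrow> ran f \<subseteq> X"
  by (simp add: charts_def)

lemma charts_dom_subset: "f \<in> charts X \<Longrightarrow> dom f \<subseteq> X"
  by (simp add: charts_def)

lemma dom_map_comp: "dom (g \<circ>\<^sub>m f) = {x \<in> dom f. the (f x) \<in> dom g}"
  by (auto simp: map_comp_def dom_def split: option.splits)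

lemma ran_map_comp: "ran (g \<circ>\<^sub>m f) = (\<lambda>y. the (g y)) ` (ran f \<inter> dom g)"
proof -
  have "\<exists>x. (g \<circ>\<^sub>m f) x = Some z" if "f x = Some y" "g y = Some z" for x y z
    using that by (auto intro!: exI[of _ x])
  then show ?thesis
    by (force simp: ran_def dom_def image_iff map_comp_def split: option.splits)
qed

lemma ran_eq_image: "ran f = (\<lambda>x. the (f x)) ` dom f"
  by (force simp: ran_def dom_def)

lemma charts_inj_on_the: "f \<in> charts X \<Longrightarrow> inj_on (\<lambda>x. the (f x)) (dom f)"
  by (auto simp: in_charts_iff inj_on_def dom_def)

lemma map_comp_in_charts: "f \<in> charts X \<Longrightarrow> g \<in> charts X \<Longrightarrow> g \<circ>\<^sub>m f \<in> charts X"
  using monoid.m_closed[OF monoid_sym_inv_monoid, of f X g] by (simp add: sym_inv_monoid_def)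

text \<open>A point drops out either because \<open>f\<close> is undefined there or because
  \<open>f\<close> carries it to a point where \<open>g\<close> is undefined. The two cases are
  disjoint, and injectivity of \<open>f\<close> matches the second with
  \<open>ran f - dom g\<close>, so collapse(fg) = collapse(f) + |ran f - dom g|.\<close>

lemma collapse_split:
  assumes "f \<in> charts X"
  shows "X - dom (g \<circ>\<^sub>m f) = (X - dom f) \<union> {x \<in> dom f. the (f x) \<in> ran f - dom g}"
  using charts_dom_subset[OF assms] by (auto simp: dom_map_comp intro: ranI)

text \<open>Dually, the points lost from \<open>ran g\<close> are the values of \<open>g\<close> at
  arguments that \<open>f\<close> never reaches. Injectivity of \<open>g\<close> ensures that no
  such value is attained at another argument.\<close>

lemma defect_split:
  assumes "g \<in> charts X"
  shows "X - ran (g \<circ>\<^sub>m f) = (X - ran g) \<union> (\<lambda>y. the (g y)) ` (dom g - ran f)"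
proof -
  have "ran (g \<circ>\<^sub>m f) = ran g - (\<lambda>y. the (g y)) ` (dom g - ran f)"
    using charts_inj_on_the[OF assms]
    unfolding ran_map_comp ran_eq_image[of g] inj_on_def by blast
  moreover have "(\<lambda>y. the (g y)) ` (dom g - ran f) \<subseteq> ran g"
    by (auto simp: ran_eq_image[of g])
  ultimately show ?thesis
    using charts_ran_subset[OF assms] by auto
qed

lemma bij_betw_collapse:
  assumes "f \<in> charts X"
  shows "bij_betw (\<lambda>x. the (f x)) {x \<in> dom f. the (f x) \<in> ran f - A} (ran f - A)"
  using charts_inj_on_the[OF assms] by (auto simp: bij_betw_def inj_on_def ran_eq_image[of f])

lemma finite_collapse_map_comp:
  assumes "f \<in> charts X"
  shows "finite (X - dom (g \<circ>\<^sub>m f)) \<longleftrightarrow> finite (X - dom f) \<and> finite (ran f - dom g)"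
  using bij_betw_finite[OF bij_betw_collapse[OF assms]] by (simp add: collapse_split[OF assms])

lemma finite_defect_map_comp:
  assumes "g \<in> charts X"
  shows "finite (X - ran (g \<circ>\<^sub>m f)) \<longleftrightarrow> finite (X - ran g) \<and> finite (dom g - ran f)"
proof -
  have "inj_on (\<lambda>y. the (g y)) (dom g - ran f)"
    using charts_inj_on_the[OF assms] by (rule inj_on_subset) auto
  then show ?thesis
    by (simp add: defect_split[OF assms] finite_image_iff)
qed

lemma collapse_map_comp_empty:
  assumes "f \<in> charts X"
  shows "X - dom (g \<circ>\<^sub>m f) = {} \<longleftrightarrow> X - dom f = {} \<and> ran f - dom g = {}"
  using image_is_empty[of "\<lambda>x. the (f x)" "{x \<in> dom f. the (f x) \<in> ran f - dom g}"]
  unfolding collapse_split[OF assms] Un_empty bij_betw_imp_surj_on[OF bij_betw_collapse[OF assms]]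
  by (simp only:)

lemma defect_map_comp_empty:
  assumes "g \<in> charts X"
  shows "X - ran (g \<circ>\<^sub>m f) = {} \<longleftrightarrow> X - ran g = {} \<and> dom g - ran f = {}"
  unfolding defect_split[OF assms] by auto

text \<open>Used for \<open>T\<close> and \<open>T'\<close>: once \<open>ran f\<close> is cofinite
  in \<open>X\<close>, finiteness of \<open>ran f - dom g\<close> from the product formula says that
  \<open>g\<close> has finite collapse; similarly for \<open>dom g - ran f\<close> and the defect of
  \<open>f\<close>.\<close>

lemma finite_Diff_cofinite:
  assumes "finite (X - A)" "A \<subseteq> X"
  shows "finite (A - B) \<longleftrightarrow> finite (X - B)"
proof -
  have "X - B \<subseteq> (X - A) \<union> (A - B)" "A - B \<subseteq> X - B"
    using assms(2) by auto
  then show ?thesis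
    using assms(1) by (meson finite_UnI finite_subset)
qed

section \<open>Construction of charts and permutations, and factorisation of an arbitrary
  chart\<close>

definition chart_of :: "'a set \<Rightarrow> ('a \<Rightarrow> 'a) \<Rightarrow> 'a \<rightharpoonup> 'a" where
  "chart_of A s = (\<lambda>x. if x \<in> A then Some (s x) else None)"

lemma dom_chart_of: "dom (chart_of A s) = A"
  by (auto simp: chart_of_def dom_def)

lemma ran_chart_of: "ran (chart_of A s) = s ` A"
  by (auto simp: chart_of_def ran_def)

lemma chart_of_in_charts: "inj_on s A \<Longrightarrow> A \<subseteq> X \<Longrightarrow> s ` A \<subseteq> X \<Longrightarrow> chart_of A s \<in> charts X"
  by (auto simp: in_charts_iff chart_of_def inj_on_def split: if_splits)

lemma chart_of_in_Sym: "bij_betw s X X \<Longrightarrow> chart_of X s \<in> Sym X"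
  by (auto simp: Sym_def dom_chart_of ran_chart_of bij_betw_def chart_of_in_charts)

lemma ex_chart:
  assumes "countable X" "A \<subseteq> X" "infinite A" "B \<subseteq> X" "infinite B"
  obtains f where "f \<in> charts X" "dom f = A" "ran f = B"
proof -
  have "countable A" "countable B"
    using assms countable_subset by auto
  then obtain s where "bij_betw s A B"
    using assms by (metis bij_betw_inv bij_betw_trans to_nat_on_infinite)
  then show thesis
    using assms that[of "chart_of A s"]
    by (auto simp: dom_chart_of ran_chart_of bij_betw_def chart_of_in_charts)
qed

lemma split_infinite:
  assumes "infinite Y"
  obtains A B where "Y = A \<union> B" "A \<inter> B = {}" "infinite A" "infinite B"
proof -
  obtain C :: "nat \<Rightarrow> 'a set" where C: "pairwise (\<lambda>i j. disjnt (C i) (C j)) UNIV"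
      "(\<Union>i. C i) \<subseteq> Y" "\<And>i. infinite (C i)"
    using infinite_infinite_partition[OF assms] by blast
  have "C 1 \<inter> C 0 = {}"
    using C(1) by (metis UNIV_I disjnt_def pairwiseD zero_neq_one)
  then have "C 1 \<subseteq> Y - C 0"
    using C(2) by auto
  then have "infinite (Y - C 0)"
    using C(3) infinite_super by blast
  then show thesis
    using that[of "C 0" "Y - C 0"] C(2,3) by auto
qed

text \<open>The condition forces \<open>p\<close> to be t s^-1 on the image of \<open>s\<close>. The
  two leftover sets are both countably infinite, so any bijection between them completes
  \<open>p\<close>.\<close>

lemma extend_to_permutation:
  assumes X: "countable X"
    and s: "inj_on s X" "s ` X \<subseteq> X" "infinite (X - s ` X)"
    and t: "inj_on t X" "t ` X \<subseteq> X" "infinite (X - t ` X)"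
  obtains p where "bij_betw p X X" "\<And>x. x \<in> X \<Longrightarrow> p (s x) = t x"
proof -
  have "countable (X - s ` X)" "countable (X - t ` X)"
    using X by auto
  then obtain r where r: "bij_betw r (X - s ` X) (X - t ` X)"
    using s t by (metis bij_betw_inv bij_betw_trans to_nat_on_infinite)
  define p where "p = (\<lambda>z. if z \<in> s ` X then t (inv_into X s z) else r z)"
  have ps: "p (s x) = t x" if "x \<in> X" for x
    using that s by (simp add: p_def)
  have "bij_betw p (s ` X) (t ` X)"
  proof (rule bij_betw_imageI)
    show "inj_on p (s ` X)"
      using t(1) by (auto simp: inj_on_def ps)
    show "p ` s ` X = t ` X"
      by (auto simp: ps image_iff)
  qed
  moreover have "bij_betw p (X - s ` X) (X - t ` X)"
    using r by (rule bij_betw_cong[THEN iffD1, rotated]) (auto simp: p_def)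
  ultimately have "bij_betw p (s ` X \<union> (X - s ` X)) (t ` X \<union> (X - t ` X))"
    by (rule bij_betw_combine) auto
  moreover have "s ` X \<union> (X - s ` X) = X" "t ` X \<union> (X - t ` X) = X"
    using s t by auto
  ultimately show thesis
    using that ps by auto
qed

text \<open>It suffices to find an injection \<open>t\<close> of \<open>X\<close> into
  \<open>X\<close> with infinite co-image that \<open>b\<close> turns into \<open>f\<close>; a
  permutation then carries the injection given by \<open>a\<close> to \<open>t\<close>.\<close>

lemma factor_chart:
  assumes X: "countable X" "infinite X"
    and a: "a \<in> charts X" "dom a = X" "infinite (X - ran a)"
    and b: "b \<in> charts X" "ran b = X" "infinite (X - dom b)"
    and f: "f \<in> charts X"
  obtains s where "s \<in> Sym X" "f = b \<circ>\<^sub>m (s \<circ>\<^sub>m a)"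
proof -
  \<comment> \<open>Points outside \<open>dom f\<close> will be sent into \<open>E\<close>, where
    \<open>b\<close> is undefined; \<open>E'\<close> is held back to keep the co-image of
    \<open>t\<close> infinite.\<close>
  obtain E E' where E: "X - dom b = E \<union> E'" "E \<inter> E' = {}" "infinite E" "infinite E'"
    using split_infinite[OF b(3)] .
  have "countable E"
    using X(1) E(1) by (metis countable_Diff countable_Un_iff)
  then obtain e where e: "bij_betw e X E"
    using E X by (metis bij_betw_inv bij_betw_trans to_nat_on_infinite)
  have "\<forall>y\<in>X. \<exists>z. b z = Some y"
    using b(2) by (auto simp: ran_def)
  then obtain B where B: "\<And>y. y \<in> X \<Longrightarrow> b (B y) = Some y"
    by metis
  \<comment> \<open>Where \<open>f\<close> is defined, \<open>t\<close> picks the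
    \<open>b\<close>-preimage of the value; elsewhere it hides the point in
    \<open>E\<close>.\<close>
  define t where "t x = (case f x of Some y \<Rightarrow> B y | None \<Rightarrow> e x)" for x
  have t_Some: "t x = B y" "b (t x) = Some y" if "f x = Some y" for x y
    using f that B by (auto simp: t_def in_charts_iff)
  have t_None: "t x = e x" "b (t x) = None" "t x \<in> E" if "f x = None" "x \<in> X" for x
    using that E(1) bij_betw_apply[OF e] by (auto simp: t_def dom_def)
  have bt: "b (t x) = f x" if "x \<in> X" for x
    using that t_Some t_None by (cases "f x") auto
  have inj: "inj_on t X"
  proof (rule inj_onI)
    fix x x' assume x: "x \<in> X" "x' \<in> X" and eq: "t x = t x'"
    then have "f x = f x'"
      using bt by metis
    \<comment> \<open>If \<open>f x\<close> is defined, injectivity of \<open>f\<close> applies; if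
      not, both points went through \<open>e\<close>, which is injective.\<close>
    then show "x = x'"
      using f e x eq t_None by (cases "f x") (simp_all add: in_charts_iff bij_betw_def inj_on_def, metis)
  qed
  have tX: "t ` X \<subseteq> dom b \<union> E"
  proof
    fix z assume "z \<in> t ` X"
    then obtain x where "x \<in> X" "z = t x"
      by auto
    then show "z \<in> dom b \<union> E"
      using t_Some t_None by (cases "f x") (auto simp: dom_def)
  qed
  have sub: "t ` X \<subseteq> X"
    using tX E(1) charts_dom_subset[OF b(1)] by auto
  have "E' \<subseteq> X - t ` X"
    using tX E(1,2) by auto
  then have inf_t: "infinite (X - t ` X)"
    using E(4) infinite_super by blast
  have inj_a: "inj_on (\<lambda>x. the (a x)) X" and ran_a: "ran a = (\<lambda>x. the (a x)) ` X"
    using charts_inj_on_the[OF a(1)] a(2) ran_eq_image[of a] by simp_all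
  have "(\<lambda>x. the (a x)) ` X \<subseteq> X" "infinite (X - (\<lambda>x. the (a x)) ` X)"
    using charts_ran_subset[OF a(1)] a(3) unfolding ran_a .
  then obtain p where p: "bij_betw p X X" "\<And>x. x \<in> X \<Longrightarrow> p (the (a x)) = t x"
    using extend_to_permutation[OF X(1) inj_a _ _ inj sub inf_t] by blast
  have "f x = (b \<circ>\<^sub>m (chart_of X p \<circ>\<^sub>m a)) x" for x
  proof (cases "x \<in> X")
    case True
    then obtain z where z: "a x = Some z" "z \<in> X"
      using a(1,2) by (auto simp: dom_def in_charts_iff)
    then show ?thesis
      using True p(2)[OF True] bt by (simp add: map_comp_def chart_of_def)
  next
    case False
    then have "a x = None" "f x = None"
      using charts_dom_subset[OF a(1)] charts_dom_subset[OF f] by auto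
    then show ?thesis
      by simp
  qed
  then have "f = b \<circ>\<^sub>m (chart_of X p \<circ>\<^sub>m a)" ..
  then show thesis
    using that chart_of_in_Sym[OF p(1)] by simp
qed

section \<open>Lowering a finite collapse or defect to zero\<close>

lemma bij_betw_transpose: "p \<in> X \<Longrightarrow> q \<in> X \<Longrightarrow> bij_betw (transpose p q) X X"
  by (simp add: bij_betw_def)

text \<open>
  A point outside \<open>ran u\<close> is moved onto a point outside \<open>dom g\<close>, which is thereby absorbed: this
  lowers the finite collapse by at least one.
\<close>

lemma ex_collapse_empty:
  assumes mult: "\<And>f g. f \<in> U \<Longrightarrow> g \<in> U \<Longrightarrow> g \<circ>\<^sub>m f \<in> U" and U: "Sym X \<subseteq> U" "U \<subseteq> charts X"
    and u: "u \<in> U" "X - dom u = {}" "X - ran u \<noteq> {}"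
    and g: "g \<in> U" "finite (X - dom g)" "infinite (X - ran g)"
  shows "\<exists>a\<in>U. X - dom a = {} \<and> infinite (X - ran a)"
  using g
proof (induction "card (X - dom g)" arbitrary: g rule: less_induct)
  case less
  show ?case
  proof (cases "X - dom g = {}")
    case False
    then obtain p q where pq: "p \<in> X - ran u" "q \<in> X - dom g"
      using u by blast
    define s where "s = chart_of X (transpose p q)"
    have s: "s \<in> Sym X"
      unfolding s_def using pq by (intro chart_of_in_Sym bij_betw_transpose) auto
    \<comment> \<open>Since \<open>u\<close> misses \<open>p\<close>, following it by the swap gives
      a total chart that misses \<open>q\<close>.\<close>
    define h where "h = s \<circ>\<^sub>m u"
    have hU: "h \<in> U"
      using mult s u U by (auto simp: h_def)
    have "X - dom h = {}"
      using u(1,2) U s collapse_map_comp_empty[of u X s] charts_ran_subset[of u X]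
      unfolding h_def Sym_def by blast
    moreover have "q \<notin> ran h"
      using pq unfolding h_def
      by (auto simp: ran_map_comp s_def chart_of_def dom_def transpose_def split: if_splits)
    moreover have hc: "h \<in> charts X" and gc: "g \<in> charts X"
      using U hU less.prems by auto
    \<comment> \<open>As \<open>h\<close> is total, only the gaps of \<open>g\<close> hit by
      \<open>h\<close> contribute to the collapse of the product, and the gap \<open>q\<close> is
      not hit.\<close>
    ultimately have "ran h - dom g \<subset> X - dom g" "X - dom (g \<circ>\<^sub>m h) = {x \<in> dom h. the (h x) \<in> ran h - dom g}"
      using pq charts_ran_subset[of h X] by (auto simp: collapse_split)
    then have "card (X - dom (g \<circ>\<^sub>m h)) < card (X - dom g)" "finite (ran h - dom g)"
      using bij_betw_same_card[OF bij_betw_collapse[OF hc, of "dom g"]] less.prems(2)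
      by (auto simp: psubset_card_mono finite_subset)
    moreover have "finite (X - dom (g \<circ>\<^sub>m h))"
      unfolding finite_collapse_map_comp[OF hc] \<open>X - dom h = {}\<close>
      using \<open>finite (ran h - dom g)\<close> by simp
    \<comment> \<open>\<open>g\<close> acts last, so whatever it misses the product misses
      too.\<close>
    moreover have "infinite (X - ran (g \<circ>\<^sub>m h))"
      using less.prems(3) by (simp add: finite_defect_map_comp[OF gc])
    ultimately show ?thesis
      using less.hyps[of "g \<circ>\<^sub>m h"] mult hU less.prems(1) by blast
  qed (use less.prems in blast)
qed

text \<open>The mirror image: the swap is now applied before \<open>u\<close>, so that
  \<open>h\<close> is still onto \<open>X\<close> but undefined at a point \<open>q\<close> missed
  by \<open>g\<close>. In the product \<open>g\<close> followed by \<open>h\<close>, the defect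
  counts only \<open>dom h - ran g\<close>, which lacks \<open>q\<close>, while the infinite
  collapse of \<open>g\<close> survives because \<open>g\<close> acts first.\<close>

lemma ex_defect_empty:
  assumes mult: "\<And>f g. f \<in> U \<Longrightarrow> g \<in> U \<Longrightarrow> g \<circ>\<^sub>m f \<in> U" and U: "Sym X \<subseteq> U" "U \<subseteq> charts X"
    and u: "u \<in> U" "X - dom u \<noteq> {}" "X - ran u = {}"
    and g: "g \<in> U" "infinite (X - dom g)" "finite (X - ran g)"
  shows "\<exists>b\<in>U. infinite (X - dom b) \<and> X - ran b = {}"
  using g
proof (induction "card (X - ran g)" arbitrary: g rule: less_induct)
  case less
  show ?case
  proof (cases "X - ran g = {}")
    case False
    then obtain p q where pq: "p \<in> X - dom u" "q \<in> X - ran g"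
      using u by blast
    define s where "s = chart_of X (transpose p q)"
    have s: "s \<in> Sym X"
      unfolding s_def using pq by (intro chart_of_in_Sym bij_betw_transpose) auto
    define h where "h = u \<circ>\<^sub>m s"
    have hU: "h \<in> U"
      using mult s u U by (auto simp: h_def)
    have "X - ran h = {}"
      using u(1,3) U s defect_map_comp_empty[of u X s] charts_dom_subset[of u X]
      unfolding h_def Sym_def by blast
    moreover have "q \<notin> dom h"
      using pq unfolding h_def
      by (auto simp: dom_map_comp s_def chart_of_def dom_def transpose_def split: if_splits)
    moreover have hc: "h \<in> charts X" and gc: "g \<in> charts X"
      using U hU less.prems by auto
    ultimately have sub: "dom h - ran g \<subset> X - ran g"
      and eq: "X - ran (h \<circ>\<^sub>m g) = (\<lambda>y. the (h y)) ` (dom h - ran g)"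
      using pq charts_dom_subset[of h X] by (auto simp: defect_split)
    have "finite (dom h - ran g)"
      using sub less.prems(3) finite_subset by blast
    moreover from this have "card (X - ran (h \<circ>\<^sub>m g)) < card (X - ran g)"
      unfolding eq by (rule le_less_trans[OF card_image_le psubset_card_mono[OF less.prems(3) sub]])
    moreover have "finite (X - ran (h \<circ>\<^sub>m g))"
      unfolding finite_defect_map_comp[OF hc] \<open>X - ran h = {}\<close>
      using \<open>finite (dom h - ran g)\<close> by simp
    moreover have "infinite (X - dom (h \<circ>\<^sub>m g))"
      using less.prems(2) by (simp add: finite_collapse_map_comp[OF gc])
    ultimately show ?thesis
      using less.hyps[of "h \<circ>\<^sub>m g"] mult hU less.prems(1) by blast
  qed (use less.prems in blast)
qed

section \<open>Recognising maximal subsemigroups through an antichain\<close>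

lemma maximal_subsemigroups_eqI:
  assumes sub: "\<And>A. A \<in> \<C> \<Longrightarrow> subsemigroup A G \<and> A \<noteq> carrier G \<and> K \<subseteq> A"
    and antichain: "\<And>A B. A \<in> \<C> \<Longrightarrow> B \<in> \<C> \<Longrightarrow> A \<subseteq> B \<Longrightarrow> A = B"
    and above: "\<And>N. subsemigroup N G \<Longrightarrow> K \<subseteq> N \<Longrightarrow> N \<noteq> carrier G \<Longrightarrow> \<exists>A\<in>\<C>. N \<subseteq> A"
  shows "{M. maximal_subsemigroup M G \<and> K \<subseteq> M} = \<C>"
proof (intro equalityI subsetI)
  fix M assume "M \<in> {M. maximal_subsemigroup M G \<and> K \<subseteq> M}"
  then have M: "subsemigroup M G" "K \<subseteq> M" "M \<noteq> carrier G"
    and max: "\<And>N. subsemigroup N G \<Longrightarrow> N \<noteq> carrier G \<Longrightarrow> M \<subseteq> N \<Longrightarrow> N = M"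
    by (auto simp: maximal_subsemigroup_def)
  obtain A where A: "A \<in> \<C>" "M \<subseteq> A"
    using above[OF M] by blast
  \<comment> \<open>\<open>A\<close> is a proper subsemigroup above the maximal
    \<open>M\<close>.\<close>
  have "A = M"
    using max[OF _ _ A(2)] sub[OF A(1)] by simp
  with A(1) show "M \<in> \<C>"
    by simp
next
  fix M assume M: "M \<in> \<C>"
  have "N = M" if N: "subsemigroup N G" "N \<noteq> carrier G" "M \<subseteq> N" for N
  proof -
    obtain A where "A \<in> \<C>" "N \<subseteq> A"
      using above[of N] N sub[OF M] by auto
    \<comment> \<open>In the chain \<open>M\<close>, \<open>N\<close>, \<open>A\<close> the two ends
      belong to the antichain and so coincide, squeezing \<open>N\<close>.\<close>
    then show ?thesis
      using antichain[OF M] N(3) by auto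
  qed
  then show "M \<in> {M. maximal_subsemigroup M G \<and> K \<subseteq> M}"
    using sub[OF M] unfolding maximal_subsemigroup_def by simp
qed

section \<open>The four sets: closure, incomparability and maximality\<close>

theorem theorem3p19:
  fixes X :: "'a set" and S S' T T' :: "('a \<rightharpoonup> 'a) set"
  assumes "countable X" and "infinite X"
  defines "S \<equiv> {f \<in> carrier (sym_inv_monoid X).
                  (czero :: 'a rel) <o collapse X f \<or> defect X f =o (czero :: 'a rel)}"
    and "S' \<equiv> {f \<in> carrier (sym_inv_monoid X).
                  collapse X f =o (czero :: 'a rel) \<or> (czero :: 'a rel) <o defect X f}"
    and "T \<equiv> {f \<in> carrier (sym_inv_monoid X).
                  collapse X f =o natLeq \<or> defect X f <o natLeq}"
    and "T' \<equiv> {f \<in> carrier (sym_inv_monoid X).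
                  collapse X f <o natLeq \<or> defect X f =o natLeq}"
  shows "{M. maximal_subsemigroup M (sym_inv_monoid X) \<and> Sym X \<subseteq> M} = {S, S', T, T'}
         \<and> card {S, S', T, T'} = 4"
proof -
  let ?I = "sym_inv_monoid X"
  have simps: "carrier ?I = charts X" "f \<otimes>\<^bsub>?I\<^esub> g = g \<circ>\<^sub>m f" for f g
    by (simp_all add: sym_inv_monoid_def)
  \<comment> \<open>Every complement in \<open>X\<close> is countable, so being infinite is the same
    as having size aleph-zero.\<close>
  have cd: "countable (X - A)" for A
    using assms(1) by simp
  note card_simps = simps collapse_def defect_def card_of_eq_czero_iff czero_less_card_of_iff
    card_of_eq_natLeq_iff[OF cd] finite_iff_ordLess_natLeq[symmetric]
  have S: "S = {f \<in> charts X. X - dom f \<noteq> {} \<or> X - ran f = {}}"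
    and S': "S' = {f \<in> charts X. X - dom f = {} \<or> X - ran f \<noteq> {}}"
    and T: "T = {f \<in> charts X. infinite (X - dom f) \<or> finite (X - ran f)}"
    and T': "T' = {f \<in> charts X. finite (X - dom f) \<or> infinite (X - ran f)}"
    unfolding assms(3-6) card_simps by (rule refl)+

  have Sym: "Sym X \<subseteq> S" "Sym X \<subseteq> S'" "Sym X \<subseteq> T" "Sym X \<subseteq> T'"
    by (auto simp: S S' T T' Sym_def)
  have "chart_of X id \<in> Sym X"
    by (simp add: chart_of_in_Sym)
  then have nonempty: "S \<noteq> {}" "S' \<noteq> {}" "T \<noteq> {}" "T' \<noteq> {}"
    using Sym by blast+
  have subsemigroupI: "subsemigroup A ?I"
    if "A \<noteq> {}" "A \<subseteq> charts X" "\<And>f g. f \<in> A \<Longrightarrow> g \<in> A \<Longrightarrow> g \<circ>\<^sub>m f \<in> A" for A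
    using that by (simp add: subsemigroup_def simps)
  have sub_X: "dom f \<subseteq> X" "ran f \<subseteq> X" if "f \<in> charts X" for f
    using that by (simp_all add: charts_def)
  have "subsemigroup S ?I"
  proof (rule subsemigroupI)
    fix f g assume fg: "f \<in> S" "g \<in> S"
    then have c: "f \<in> charts X" "g \<in> charts X"
      by (auto simp: S)
    \<comment> \<open>If the product has collapse 0, then \<open>f\<close> has collapse 0, hence
      defect 0 by membership in \<open>S\<close>. So \<open>g\<close> must be total, hence also has
      defect 0, and the product is onto.\<close>
    show "g \<circ>\<^sub>m f \<in> S"
      using fg map_comp_in_charts[OF c] sub_X[OF c(1)] sub_X[OF c(2)]
      unfolding S mem_Collect_eq collapse_map_comp_empty[OF c(1)] defect_map_comp_empty[OF c(2)]
      by blast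
  qed (use nonempty S in auto)
  moreover have "subsemigroup S' ?I"
  proof (rule subsemigroupI)
    fix f g assume fg: "f \<in> S'" "g \<in> S'"
    then have c: "f \<in> charts X" "g \<in> charts X"
      by (auto simp: S')
    \<comment> \<open>The same chain run backwards, from defect 0 of the product through
      \<open>g\<close> to \<open>f\<close>.\<close>
    show "g \<circ>\<^sub>m f \<in> S'"
      using fg map_comp_in_charts[OF c] sub_X[OF c(1)] sub_X[OF c(2)]
      unfolding S' mem_Collect_eq collapse_map_comp_empty[OF c(1)] defect_map_comp_empty[OF c(2)]
      by blast
  qed (use nonempty S' in auto)
  moreover have "subsemigroup T ?I"
  proof (rule subsemigroupI)
    fix f g assume fg: "f \<in> T" "g \<in> T"
    then have c: "f \<in> charts X" "g \<in> charts X"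
      by (auto simp: T)
    \<comment> \<open>The argument for \<open>S\<close> with "zero" weakened to "finite": finite
      collapse passes to \<open>f\<close>, then finite defect of \<open>f\<close> makes the collapse
      of \<open>g\<close> finite too.\<close>
    show "g \<circ>\<^sub>m f \<in> T"
      using fg map_comp_in_charts[OF c] finite_Diff_cofinite[OF _ sub_X(2)[OF c(1)]]
        finite_Diff_cofinite[OF _ sub_X(1)[OF c(2)]]
      unfolding T mem_Collect_eq finite_collapse_map_comp[OF c(1)] finite_defect_map_comp[OF c(2)]
      by blast
  qed (use nonempty T in auto)
  moreover have "subsemigroup T' ?I"
  proof (rule subsemigroupI)
    fix f g assume fg: "f \<in> T'" "g \<in> T'"
    then have c: "f \<in> charts X" "g \<in> charts X"
      by (auto simp: T')
    show "g \<circ>\<^sub>m f \<in> T'"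
      using fg map_comp_in_charts[OF c] finite_Diff_cofinite[OF _ sub_X(2)[OF c(1)]]
        finite_Diff_cofinite[OF _ sub_X(1)[OF c(2)]]
      unfolding T' mem_Collect_eq finite_collapse_map_comp[OF c(1)] finite_defect_map_comp[OF c(2)]
      by blast
  qed (use nonempty T' in auto)
  ultimately have sub: "subsemigroup A ?I" if "A \<in> {S, S', T, T'}" for A
    using that by blast

  obtain z where z: "z \<in> X"
    using assms(2) by fastforce
  \<comment> \<open>\<open>P\<close> omits one point and \<open>H\<close> below omits infinitely
    many. Using \<open>X\<close>, \<open>P\<close> and \<open>H\<close> as domains and images gives
    charts \<open>w1\<close> to \<open>w4\<close>, each lying in all but one of the four
    sets.\<close>
  define P where "P = X - {z}"
  have P: "P \<subseteq> X" "infinite P" "X - P \<noteq> {}" "finite (X - P)"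
    using assms(2) z by (auto simp: P_def Diff_Diff_Int)
  obtain H H' where H: "X = H \<union> H'" "H \<inter> H' = {}" "infinite H" "infinite H'"
    using split_infinite[OF assms(2)] .
  then have H: "H \<subseteq> X" "infinite H" "X - H \<noteq> {}" "infinite (X - H)"
    by (auto simp: Un_Diff Diff_triv Int_commute)
  obtain w1 where "w1 \<in> charts X" "dom w1 = X" "ran w1 = P"
    using ex_chart[OF assms(1) subset_refl assms(2) P(1,2)] .
  then have w1: "w1 \<in> S' \<inter> T \<inter> T' - S"
    using P by (simp add: S S' T T')
  obtain w2 where "w2 \<in> charts X" "dom w2 = P" "ran w2 = X"
    using ex_chart[OF assms(1) P(1,2) subset_refl assms(2)] .
  then have w2: "w2 \<in> S \<inter> T \<inter> T' - S'"
    using P by (simp add: S S' T T')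
  obtain w3 where "w3 \<in> charts X" "dom w3 = P" "ran w3 = H"
    using ex_chart[OF assms(1) P(1,2) H(1,2)] .
  then have w3: "w3 \<in> S \<inter> S' \<inter> T' - T"
    using P H by (simp add: S S' T T')
  obtain w4 where "w4 \<in> charts X" "dom w4 = H" "ran w4 = P"
    using ex_chart[OF assms(1) H(1,2) P(1,2)] .
  then have w4: "w4 \<in> S \<inter> S' \<inter> T - T'"
    using P H by (simp add: S S' T T')
  \<comment> \<open>An inclusion between two different sets is refuted by the chart that the larger
    one omits.\<close>
  have incomparable: "\<not> S \<subseteq> S'" "\<not> S \<subseteq> T" "\<not> S \<subseteq> T'" "\<not> S' \<subseteq> S" "\<not> S' \<subseteq> T" "\<not> S' \<subseteq> T'"
      "\<not> T \<subseteq> S" "\<not> T \<subseteq> S'" "\<not> T \<subseteq> T'" "\<not> T' \<subseteq> S" "\<not> T' \<subseteq> S'" "\<not> T' \<subseteq> T"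
    using w1 w2 w3 w4 by auto
  have le: "S \<subseteq> charts X" "S' \<subseteq> charts X" "T \<subseteq> charts X" "T' \<subseteq> charts X"
    by (simp_all add: S S' T T')

  have "{M. maximal_subsemigroup M ?I \<and> Sym X \<subseteq> M} = {S, S', T, T'}"
  proof (rule maximal_subsemigroups_eqI)
    fix A assume A: "A \<in> {S, S', T, T'}"
    have "A \<noteq> carrier ?I"
      using A incomparable le unfolding simps by auto
    then show "subsemigroup A ?I \<and> A \<noteq> carrier ?I \<and> Sym X \<subseteq> A"
      using sub[OF A] A Sym by auto
    fix B assume "B \<in> {S, S', T, T'}" "A \<subseteq> B"
    then show "A = B"
      using A incomparable by auto
  next
    fix U assume "subsemigroup U ?I" and Sym: "Sym X \<subseteq> U" and "U \<noteq> carrier ?I"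
    then have U: "U \<subseteq> charts X" and mult: "\<And>f g. f \<in> U \<Longrightarrow> g \<in> U \<Longrightarrow> g \<circ>\<^sub>m f \<in> U"
      and proper: "\<not> charts X \<subseteq> U"
      by (auto simp: subsemigroup_def simps)
    show "\<exists>A\<in>{S, S', T, T'}. U \<subseteq> A"
    proof (rule ccontr)
      assume "\<not> (\<exists>A\<in>{S, S', T, T'}. U \<subseteq> A)"
      then obtain u1 u2 u3 u4 where u: "u1 \<in> U - S" "u2 \<in> U - S'" "u3 \<in> U - T" "u4 \<in> U - T'"
        by auto
      \<comment> \<open>Outside \<open>S\<close> means collapse 0 and nonzero defect; outside
        \<open>T\<close> means finite collapse and infinite defect. So \<open>u1\<close> serves to
        repair the collapse of \<open>u3\<close>.\<close>
      obtain a where a: "a \<in> U" "X - dom a = {}" "infinite (X - ran a)"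
        using ex_collapse_empty[OF mult Sym U, of u1 u3] u U unfolding S T by blast
      \<comment> \<open>Dually, \<open>u2\<close> is onto but not total, and it repairs the finite
        defect of \<open>u4\<close>.\<close>
      obtain b where b: "b \<in> U" "infinite (X - dom b)" "X - ran b = {}"
        using ex_defect_empty[OF mult Sym U, of u2 u4] u U unfolding S' T' by blast
      have eq: "a \<in> charts X" "dom a = X" "b \<in> charts X" "ran b = X"
        using a b U charts_dom_subset[of a X] charts_ran_subset[of b X] by auto
      have "charts X \<subseteq> U"
      proof
        fix f assume "f \<in> charts X"
        then obtain s where "s \<in> Sym X" "f = b \<circ>\<^sub>m (s \<circ>\<^sub>m a)"
          using factor_chart[OF assms(1,2) eq(1,2) a(3) eq(3,4) b(2)] by metis
        then show "f \<in> U"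
          using mult a(1) b(1) Sym by auto
      qed
      with proper show False ..
    qed
  qed
  moreover have "card {S, S', T, T'} = 4"
  proof -
    have "S \<noteq> S'" "S \<noteq> T" "S \<noteq> T'" "S' \<noteq> T" "S' \<noteq> T'" "T \<noteq> T'"
      using incomparable by auto
    then show ?thesis
      by simp
  qed
  ultimately show ?thesis ..
qed

end
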